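(* Let $\Upsilon=(\Gamma,\sigma,\varphi)$ be a gain signed graph with orientation $\tau$, let $\zeta:V\to\{\pm1\}$ be a sign switcher and $\theta:V\to\mathbb{K}$ a gain switcher. For every edge set $S\subseteq E$, $S$ is hyperbalanced in $\Upsilon$ if and only if it is hyperbalanced in the sign-switched graph $\Upsilon^\zeta$, and if and only if it is hyperbalanced in the gain-switched graph $(\Gamma,\sigma,\varphi^\theta)$.
   Context: Let $\mathbb{K}$ be a field of characteristic $\ne2$. A graph $\Gamma=(V,E)$ has vertex set $V=\{v_1,\dots,v_n\}$ and finite edge set $E$; edges are links (two ends at distinct vertices), loops (two ends at one vertex), half edges (one end) or loose edges (no ends); parallel edges allowed. A gain signed graph $\Upsilon=(\Gamma,\sigma,\varphi)$: $\sigma:E\to\{\pm1\}$ (half edges negative, loose edges positive); with an orientation $\tau$ (signs $\tau(v,e)\in\{\pm1\}$ on edge ends, $\tau(v,e)\tau(w,e)=-\sigma(e)$ for a link or loop with ends $v,w$) each edge has gain $\varphi(e)\in\mathbb{K}$, negated on reorientation. Neutral = gain $0$. Walk gain of $W=u_0e_1\cdots e_lu_l$: $\varphi(W)=-\sum_i\varphi(e_i)\sigma(W_{0,i-1})\tau(u_{i-1},e_i)$, $\sigma(W_{0,j})=\prod_{i\le j}\sigma(e_i)$. Ultrawalks may begin with a half edge $e_0$ at $u_0$ and/or end with a half edge $e_{l+1}$ at $u_l$; their gain adds $\tau(u_0,e_0)\varphi(e_0)$ and/or $-\varphi(e_{l+1})\sigma(W_{0,l})\tau(u_l,e_{l+1})$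 to $\varphi(W_{0,l})$. Circles: connected 2-regular subgraphs, sign = product of edge signs; a negative figure is a negative circle or a half edge. A sign circuit is a positive circle, a loose edge, or a handcuff (two negative figures with exactly one common vertex, or two disjoint negative figures plus a path joining them meeting them only at its ends). Its gain: the edge gain for a loose edge; else $\varphi(W)$ for a circuit walk (once around a positive circle; for a handcuff with figures $C_1,C_2$, connecting path $P$ of length $\ge0$: around $C_1$, along $P$, around $C_2$, back along $P$ if both circles; from half edge $C_1$ along $P$, around $C_2$, back, ending with $C_1$ if $C_1$ half edge and $C_2$ circle; from one half edge along $P$ to the other if both half edges); well defined up to sign; neutral if $0$. $S$ is hyperbalanced if all sign circuits contained in $S$ are neutral. Sign switching by $\zeta$: $\Upsilon^\zeta$ has $\sigma^\zeta(e)=\zeta(v)\sigma(e)\zeta(w)$ for a link or loop with ends $v,w$ (half and loose edges keep their signs), orientation $\tau^\zeta(v,e)=\zeta(v)\tau(v,e)$, and unchanged gains. Gain switching by $\theta$: $\varphi^\theta(e)=\tau(v,e)\theta(v)+\varphi(e)+\tau(w,e)\theta(w)$ for a link or loop with ends $v,w$, $\varphi^\theta(e)=\tau(v,e)\theta(v)+\varphi(e)$ for a half edge at $v$, $\varphi^\theta(e)=\varphi(e)$ for a loose edge. *)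

theory Defs
  imports Main
begin

text \<open>
  \<open>ends \<Upsilon> e\<close> lists the vertices at the ends of \<open>e\<close>: \<open>[v, w]\<close> with \<open>v \<noteq> w\<close> for a link,
  \<open>[v, v]\<close> for a loop, \<open>[v]\<close> for a half edge, \<open>[]\<close> for a loose edge. The listing order
  carries no meaning; it only makes it possible to name the individual ends. In particular the two
  ends of a loop, which cannot be told apart by their vertex, are the positions \<open>0\<close> and \<open>1\<close>,
  and \<open>orient \<Upsilon> e i\<close> is the sign \<open>\<tau>(v,e)\<close> at the end in position \<open>i\<close>.
  Reorienting an edge negates its gain, so \<open>gain \<Upsilon> e\<close> is the gain of \<open>e\<close> in the
  orientation \<open>orient \<Upsilon>\<close>.
\<close>

record ('v, 'e, 'k) gsg =
  verts  :: "'v set"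
  edges  :: "'e set"
  ends   :: "'e \<Rightarrow> 'v list"
  esign  :: "'e \<Rightarrow> int"
  orient :: "'e \<Rightarrow> nat \<Rightarrow> int"
  gain   :: "'e \<Rightarrow> 'k"

locale gain_signed_graph =
  fixes \<Upsilon> :: "('v, 'e, 'k::field) gsg"
  assumes finite_verts: "finite (verts \<Upsilon>)"
    and finite_edges: "finite (edges \<Upsilon>)"
    and ends_in_verts: "e \<in> edges \<Upsilon> \<Longrightarrow> set (ends \<Upsilon> e) \<subseteq> verts \<Upsilon>"
    and at_most_two_ends: "e \<in> edges \<Upsilon> \<Longrightarrow> length (ends \<Upsilon> e) \<le> 2"
    and esign_values: "e \<in> edges \<Upsilon> \<Longrightarrow> esign \<Upsilon> e \<in> {1, -1}"
    and half_edge_negative: "e \<in> edges \<Upsilon> \<Longrightarrow> length (ends \<Upsilon> e) = 1 \<Longrightarrow> esign \<Upsilon> e = -1"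
    and loose_edge_positive: "e \<in> edges \<Upsilon> \<Longrightarrow> ends \<Upsilon> e = [] \<Longrightarrow> esign \<Upsilon> e = 1"
    and orient_values:
      "e \<in> edges \<Upsilon> \<Longrightarrow> i < length (ends \<Upsilon> e) \<Longrightarrow> orient \<Upsilon> e i \<in> {1, -1}"
    and orient_esign:
      "e \<in> edges \<Upsilon> \<Longrightarrow> length (ends \<Upsilon> e) = 2 \<Longrightarrow>
        orient \<Upsilon> e 0 * orient \<Upsilon> e 1 = - esign \<Upsilon> e"

definition ordinary_edge :: "('v, 'e, 'k) gsg \<Rightarrow> 'e \<Rightarrow> bool" where
  "ordinary_edge \<Upsilon> e \<longleftrightarrow> e \<in> edges \<Upsilon> \<and> length (ends \<Upsilon> e) = 2"

definition half_edge :: "('v, 'e, 'k) gsg \<Rightarrow> 'e \<Rightarrow> bool" where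
  "half_edge \<Upsilon> e \<longleftrightarrow> e \<in> edges \<Upsilon> \<and> length (ends \<Upsilon> e) = 1"

definition loose_edge :: "('v, 'e, 'k) gsg \<Rightarrow> 'e \<Rightarrow> bool" where
  "loose_edge \<Upsilon> e \<longleftrightarrow> e \<in> edges \<Upsilon> \<and> ends \<Upsilon> e = []"


subsection \<open>Walks and their gains\<close>

text \<open>
  The walk \<open>u\<^sub>0 e\<^sub>1 u\<^sub>1 \<dots> e\<^sub>l u\<^sub>l\<close> is given by \<open>u\<^sub>0\<close> and the list of its steps;
  the step \<open>(e, i)\<close> traverses the link or loop \<open>e\<close> from the end in position \<open>i\<close> to the other
  one (position \<open>1 - i\<close>). So \<open>\<tau>(u\<^bsub>i-1\<^esub>, e\<^sub>i)\<close> is unambiguous also for loops.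
\<close>

type_synonym 'e step = "'e \<times> nat"

definition step_tail :: "('v, 'e, 'k) gsg \<Rightarrow> 'e step \<Rightarrow> 'v" where
  "step_tail \<Upsilon> s = ends \<Upsilon> (fst s) ! snd s"

definition step_head :: "('v, 'e, 'k) gsg \<Rightarrow> 'e step \<Rightarrow> 'v" where
  "step_head \<Upsilon> s = ends \<Upsilon> (fst s) ! (1 - snd s)"

fun walk :: "('v, 'e, 'k) gsg \<Rightarrow> 'v \<Rightarrow> 'e step list \<Rightarrow> 'v \<Rightarrow> bool" where
  "walk \<Upsilon> u [] v \<longleftrightarrow> u \<in> verts \<Upsilon> \<and> u = v"
| "walk \<Upsilon> u (s # p) v \<longleftrightarrow>
     ordinary_edge \<Upsilon> (fst s) \<and> snd s < 2 \<and> step_tail \<Upsilon> s = u \<and> walk \<Upsilon> (step_head \<Upsilon> s) p v"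

definition walk_edges :: "'e step list \<Rightarrow> 'e list" where
  "walk_edges p = map fst p"

definition walk_verts :: "('v, 'e, 'k) gsg \<Rightarrow> 'v \<Rightarrow> 'e step list \<Rightarrow> 'v list" where
  "walk_verts \<Upsilon> u p = u # map (step_head \<Upsilon>) p"

definition reverse_walk :: "'e step list \<Rightarrow> 'e step list" where
  "reverse_walk p = rev (map (\<lambda>(e, i). (e, 1 - i)) p)"

definition path :: "('v, 'e, 'k) gsg \<Rightarrow> 'v \<Rightarrow> 'e step list \<Rightarrow> 'v \<Rightarrow> bool" where
  "path \<Upsilon> u p v \<longleftrightarrow> walk \<Upsilon> u p v \<and> distinct (walk_verts \<Upsilon> u p)"

definition walk_sign :: "('v, 'e, 'k) gsg \<Rightarrow> 'e step list \<Rightarrow> int" where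
  "walk_sign \<Upsilon> p = (\<Prod>e\<leftarrow>walk_edges p. esign \<Upsilon> e)"

definition walk_gain :: "('v, 'e, 'k::field) gsg \<Rightarrow> 'e step list \<Rightarrow> 'k" where
  "walk_gain \<Upsilon> p =
    - (\<Sum>i<length p. gain \<Upsilon> (fst (p ! i)) * of_int (walk_sign \<Upsilon> (take i p))
                       * of_int (orient \<Upsilon> (fst (p ! i)) (snd (p ! i))))"

text \<open>An ultrawalk \<open>(a, p, b)\<close>: the half edges \<open>a\<close> before and \<open>b\<close> after the walk \<open>p\<close>
  may each be absent.\<close>

definition ultrawalk_gain ::
    "('v, 'e, 'k::field) gsg \<Rightarrow> 'e option \<Rightarrow> 'e step list \<Rightarrow> 'e option \<Rightarrow> 'k" where
  "ultrawalk_gain \<Upsilon> a p b =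
     (case a of None \<Rightarrow> 0 | Some e \<Rightarrow> of_int (orient \<Upsilon> e 0) * gain \<Upsilon> e)
   + walk_gain \<Upsilon> p
   + (case b of None \<Rightarrow> 0
      | Some e \<Rightarrow> - (gain \<Upsilon> e * of_int (walk_sign \<Upsilon> p) * of_int (orient \<Upsilon> e 0)))"


subsection \<open>Circles, sign circuits and hyperbalance\<close>

text \<open>None of the subgraphs below has isolated vertices, so they are given by their edge sets.\<close>

definition verts_of :: "('v, 'e, 'k) gsg \<Rightarrow> 'e set \<Rightarrow> 'v set" where
  "verts_of \<Upsilon> C = (\<Union>e\<in>C. set (ends \<Upsilon> e))"

definition degree_in :: "('v, 'e, 'k) gsg \<Rightarrow> 'e set \<Rightarrow> 'v \<Rightarrow> nat" where
  "degree_in \<Upsilon> C v = (\<Sum>e\<in>C. count_list (ends \<Upsilon> e) v)"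

definition connected_edges :: "('v, 'e, 'k) gsg \<Rightarrow> 'e set \<Rightarrow> bool" where
  "connected_edges \<Upsilon> C \<longleftrightarrow>
    (\<forall>u\<in>verts_of \<Upsilon> C. \<forall>v\<in>verts_of \<Upsilon> C. \<exists>p. walk \<Upsilon> u p v \<and> set (walk_edges p) \<subseteq> C)"

definition circle :: "('v, 'e, 'k) gsg \<Rightarrow> 'e set \<Rightarrow> bool" where
  "circle \<Upsilon> C \<longleftrightarrow> C \<noteq> {} \<and> (\<forall>e\<in>C. ordinary_edge \<Upsilon> e) \<and> connected_edges \<Upsilon> C
     \<and> (\<forall>v\<in>verts_of \<Upsilon> C. degree_in \<Upsilon> C v = 2)"

definition circle_sign :: "('v, 'e, 'k) gsg \<Rightarrow> 'e set \<Rightarrow> int" where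
  "circle_sign \<Upsilon> C = (\<Prod>e\<in>C. esign \<Upsilon> e)"

definition positive_circle :: "('v, 'e, 'k) gsg \<Rightarrow> 'e set \<Rightarrow> bool" where
  "positive_circle \<Upsilon> C \<longleftrightarrow> circle \<Upsilon> C \<and> circle_sign \<Upsilon> C = 1"

definition negative_circle :: "('v, 'e, 'k) gsg \<Rightarrow> 'e set \<Rightarrow> bool" where
  "negative_circle \<Upsilon> C \<longleftrightarrow> circle \<Upsilon> C \<and> circle_sign \<Upsilon> C = -1"

definition negative_figure :: "('v, 'e, 'k) gsg \<Rightarrow> 'e set \<Rightarrow> bool" where
  "negative_figure \<Upsilon> C \<longleftrightarrow> negative_circle \<Upsilon> C \<or> (\<exists>e. half_edge \<Upsilon> e \<and> C = {e})"

text \<open>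
  The first disjunct is the case of exactly one common vertex (connecting path of length \<open>0\<close>),
  the second that of disjoint figures. \<open>C\<^sub>1 \<noteq> C\<^sub>2\<close> is needed because a half edge or a
  negative loop has exactly one vertex in common with itself.
\<close>

definition handcuff ::
    "('v, 'e, 'k) gsg \<Rightarrow> 'e set \<Rightarrow> 'v \<Rightarrow> 'e step list \<Rightarrow> 'v \<Rightarrow> 'e set \<Rightarrow> bool" where
  "handcuff \<Upsilon> C\<^sub>1 u p v C\<^sub>2 \<longleftrightarrow>
     negative_figure \<Upsilon> C\<^sub>1 \<and> negative_figure \<Upsilon> C\<^sub>2 \<and> C\<^sub>1 \<noteq> C\<^sub>2 \<and> path \<Upsilon> u p v \<and>
     (verts_of \<Upsilon> C\<^sub>1 \<inter> verts_of \<Upsilon> C\<^sub>2 = {u} \<and> p = []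
      \<or> verts_of \<Upsilon> C\<^sub>1 \<inter> verts_of \<Upsilon> C\<^sub>2 = {}
        \<and> verts_of \<Upsilon> C\<^sub>1 \<inter> set (walk_verts \<Upsilon> u p) = {u}
        \<and> verts_of \<Upsilon> C\<^sub>2 \<inter> set (walk_verts \<Upsilon> u p) = {v})"

definition sign_circuit :: "('v, 'e, 'k) gsg \<Rightarrow> 'e set \<Rightarrow> bool" where
  "sign_circuit \<Upsilon> D \<longleftrightarrow>
     positive_circle \<Upsilon> D
   \<or> (\<exists>e. loose_edge \<Upsilon> e \<and> D = {e})
   \<or> (\<exists>C\<^sub>1 u p v C\<^sub>2. handcuff \<Upsilon> C\<^sub>1 u p v C\<^sub>2 \<and> D = C\<^sub>1 \<union> set (walk_edges p) \<union> C\<^sub>2)"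

text \<open>A closed walk that uses every edge of a circle exactly once visits no vertex twice.\<close>

definition once_around :: "('v, 'e, 'k) gsg \<Rightarrow> 'e set \<Rightarrow> 'v \<Rightarrow> 'e step list \<Rightarrow> bool" where
  "once_around \<Upsilon> C u p \<longleftrightarrow> walk \<Upsilon> u p u \<and> distinct (walk_edges p) \<and> set (walk_edges p) = C"

text \<open>
  The gain of a sign circuit is determined up to sign only, since it depends on the choice of a
  circuit walk; \<open>circuit_gain \<Upsilon> D g\<close> says that \<open>g\<close> is a value obtained from one such
  choice. A handcuff of a circle and a half edge is covered with the half edge as first figure.
\<close>

inductive circuit_gain :: "('v, 'e, 'k::field) gsg \<Rightarrow> 'e set \<Rightarrow> 'k \<Rightarrow> bool"
  for \<Upsilon> :: "('v, 'e, 'k) gsg" where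
  loose: "loose_edge \<Upsilon> e \<Longrightarrow> circuit_gain \<Upsilon> {e} (gain \<Upsilon> e)"
| circle: "positive_circle \<Upsilon> C \<Longrightarrow> once_around \<Upsilon> C u p \<Longrightarrow>
    circuit_gain \<Upsilon> C (ultrawalk_gain \<Upsilon> None p None)"
| circle_circle: "handcuff \<Upsilon> C\<^sub>1 u p v C\<^sub>2 \<Longrightarrow> negative_circle \<Upsilon> C\<^sub>1 \<Longrightarrow> negative_circle \<Upsilon> C\<^sub>2 \<Longrightarrow>
    once_around \<Upsilon> C\<^sub>1 u q\<^sub>1 \<Longrightarrow> once_around \<Upsilon> C\<^sub>2 v q\<^sub>2 \<Longrightarrow>
    circuit_gain \<Upsilon> (C\<^sub>1 \<union> set (walk_edges p) \<union> C\<^sub>2)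
      (ultrawalk_gain \<Upsilon> None (q\<^sub>1 @ p @ q\<^sub>2 @ reverse_walk p) None)"
| half_circle: "handcuff \<Upsilon> {h} u p v C\<^sub>2 \<Longrightarrow> half_edge \<Upsilon> h \<Longrightarrow> negative_circle \<Upsilon> C\<^sub>2 \<Longrightarrow>
    once_around \<Upsilon> C\<^sub>2 v q\<^sub>2 \<Longrightarrow>
    circuit_gain \<Upsilon> ({h} \<union> set (walk_edges p) \<union> C\<^sub>2)
      (ultrawalk_gain \<Upsilon> (Some h) (p @ q\<^sub>2 @ reverse_walk p) (Some h))"
| half_half: "handcuff \<Upsilon> {h} u p v {k} \<Longrightarrow> half_edge \<Upsilon> h \<Longrightarrow> half_edge \<Upsilon> k \<Longrightarrow>
    circuit_gain \<Upsilon> ({h} \<union> set (walk_edges p) \<union> {k})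
      (ultrawalk_gain \<Upsilon> (Some h) p (Some k))"

definition neutral_circuit :: "('v, 'e, 'k::field) gsg \<Rightarrow> 'e set \<Rightarrow> bool" where
  "neutral_circuit \<Upsilon> D \<longleftrightarrow> (\<forall>g. circuit_gain \<Upsilon> D g \<longrightarrow> g = 0)"

definition hyperbalanced :: "('v, 'e, 'k::field) gsg \<Rightarrow> 'e set \<Rightarrow> bool" where
  "hyperbalanced \<Upsilon> S \<longleftrightarrow> (\<forall>D\<subseteq>S. sign_circuit \<Upsilon> D \<longrightarrow> neutral_circuit \<Upsilon> D)"


subsection \<open>Switching\<close>

definition sign_switch :: "('v, 'e, 'k) gsg \<Rightarrow> ('v \<Rightarrow> int) \<Rightarrow> ('v, 'e, 'k) gsg" where
  "sign_switch \<Upsilon> \<zeta> = \<Upsilon>\<lparr>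
     esign := (\<lambda>e. case ends \<Upsilon> e of [v, w] \<Rightarrow> \<zeta> v * esign \<Upsilon> e * \<zeta> w | _ \<Rightarrow> esign \<Upsilon> e),
     orient := (\<lambda>e i. \<zeta> (ends \<Upsilon> e ! i) * orient \<Upsilon> e i)\<rparr>"

definition gain_switch ::
    "('v, 'e, 'k::field) gsg \<Rightarrow> ('v \<Rightarrow> 'k) \<Rightarrow> ('v, 'e, 'k) gsg" where
  "gain_switch \<Upsilon> \<theta> = \<Upsilon>\<lparr>
     gain := (\<lambda>e. case ends \<Upsilon> e of
         [v, w] \<Rightarrow> of_int (orient \<Upsilon> e 0) * \<theta> v + gain \<Upsilon> e + of_int (orient \<Upsilon> e 1) * \<theta> w
       | [v] \<Rightarrow> of_int (orient \<Upsilon> e 0) * \<theta> v + gain \<Upsilon> e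
       | _ \<Rightarrow> gain \<Upsilon> e)\<rparr>"

end

theory Submission
  imports Defs
begin

text \<open>
  Switch signs and gains at the same time. For a walk \<open>W\<close> from \<open>u\<close> to \<open>v\<close> the sum telescopes, so
  the new gain is \<open>\<zeta>(u) (\<phi>(W) - \<theta>(u) + \<sigma>(W) \<theta>(v))\<close>. The boundary terms cancel on a closed positive
  walk, and a half edge at either end contributes exactly the term that cancels the boundary term
  there. Hence every circuit walk changes its gain only by the factor \<open>\<zeta>(u)\<close>. Signs of circles do
  not change, because each vertex of a circle has degree two, so the sign circuits are the same.
\<close>

text \<open>Spreads the switcher factors at the ends of an edge over all vertices of a circle, with
  multiplicities that also cover loops. This common index set allows edges and vertices to be
  exchanged in \<open>circle_sign_switched\<close>.\<close>

lemma prod_list_map_eq_prod_power_count: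
  fixes f :: "'a \<Rightarrow> 'b::comm_monoid_mult"
  assumes "finite A" "set xs \<subseteq> A"
  shows "prod_list (map f xs) = (\<Prod>x\<in>A. f x ^ count_list xs x)"
  using assms(2)
proof (induction xs)
  case (Cons y ys)
  have "(\<Prod>x\<in>A. f x ^ count_list (y # ys) x)
      = (\<Prod>x\<in>A. (if x = y then f x else 1) * f x ^ count_list ys x)"
    by (intro prod.cong) auto
  also have "\<dots> = f y * (\<Prod>x\<in>A. f x ^ count_list ys x)"
    using Cons.prems assms(1) by (simp add: prod.distrib)
  finally show ?case
    using Cons by simp
qed simp

section \<open>Signs, gains and reversal of walks\<close>

lemma walk_sign_simps [simp]:
  "walk_sign \<Upsilon> [] = 1"
  "walk_sign \<Upsilon> (s # p) = esign \<Upsilon> (fst s) * walk_sign \<Upsilon> p"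
  "walk_sign \<Upsilon> (p @ q) = walk_sign \<Upsilon> p * walk_sign \<Upsilon> q"
  by (simp_all add: walk_sign_def walk_edges_def)

lemma walk_sign_reverse_walk: "walk_sign \<Upsilon> (reverse_walk p) = walk_sign \<Upsilon> p"
  by (induction p) (auto simp: reverse_walk_def mult.commute)

text \<open>The edges of the walk are distinct, so the product along the list is the product over
  the set \<open>C\<close>.\<close>

lemma walk_sign_eq_circle_sign:
  assumes "once_around \<Upsilon> C u p"
  shows "walk_sign \<Upsilon> p = circle_sign \<Upsilon> C"
  using assms by (auto simp: once_around_def walk_sign_def circle_sign_def prod.distinct_set_conv_list)

lemma walk_gain_Nil [simp]: "walk_gain \<Upsilon> [] = 0"
  by (simp add: walk_gain_def)

text \<open>The sign of the first edge divides the sign of every longer prefix, so it can be pulled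
  out of the remaining sum. This recursion opens gains to induction along the walk.\<close>

lemma walk_gain_Cons [simp]:
  "walk_gain \<Upsilon> (s # p) =
     - (gain \<Upsilon> (fst s) * of_int (orient \<Upsilon> (fst s) (snd s)))
     + of_int (esign \<Upsilon> (fst s)) * walk_gain \<Upsilon> p"
  by (simp add: walk_gain_def sum.lessThan_Suc_shift sum_distrib_left mult_ac
      del: sum.lessThan_Suc)

lemma walk_append: "walk \<Upsilon> u p v \<Longrightarrow> walk \<Upsilon> v q w \<Longrightarrow> walk \<Upsilon> u (p @ q) w"
  by (induction p arbitrary: u) auto

lemma handcuff_connecting_path:
  assumes "handcuff \<Upsilon> C\<^sub>1 u p v C\<^sub>2"
  shows "walk \<Upsilon> u p v" "u \<in> verts_of \<Upsilon> C\<^sub>1" "v \<in> verts_of \<Upsilon> C\<^sub>2"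
proof -
  show p: "walk \<Upsilon> u p v"
    using assms by (simp add: handcuff_def path_def)
  \<comment> \<open>For figures with one common vertex, \<open>handcuff\<close> places only
    \<open>u\<close> on them; the empty path identifies \<open>v\<close> with it.\<close>
  have "u = v" if "p = []"
    using p that by simp
  with assms show "u \<in> verts_of \<Upsilon> C\<^sub>1" "v \<in> verts_of \<Upsilon> C\<^sub>2"
    unfolding handcuff_def by blast+
qed

lemma (in gain_signed_graph) walk_in_verts:
  assumes "walk \<Upsilon> u p v"
  shows "u \<in> verts \<Upsilon>" "v \<in> verts \<Upsilon>"
proof -
  show "u \<in> verts \<Upsilon>"
  proof (cases p)
    case (Cons s p')
    with assms have "fst s \<in> edges \<Upsilon>" "u \<in> set (ends \<Upsilon> (fst s))"
      by (auto simp: step_tail_def ordinary_edge_def)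
    then show ?thesis using ends_in_verts by blast
  qed (use assms in auto)
  show "v \<in> verts \<Upsilon>"
    using assms by (induction p arbitrary: u) auto
qed

lemma (in gain_signed_graph) walk_reverse_walk:
  "walk \<Upsilon> u p v \<Longrightarrow> walk \<Upsilon> v (reverse_walk p) u"
proof (induction p arbitrary: u)
  case Nil
  then show ?case by (auto simp: reverse_walk_def)
next
  case (Cons s p)
  obtain e i where s: "s = (e, i)" by fastforce
  from Cons.prems have e: "ordinary_edge \<Upsilon> e" "i < 2" "u = ends \<Upsilon> e ! i"
    and p: "walk \<Upsilon> (step_head \<Upsilon> s) p v"
    by (auto simp: s step_tail_def)
  \<comment> \<open>The reversed walk ends by traversing the first edge backwards. The empty walk
    that remains at \<open>u\<close> asks for \<open>u\<close> to be a vertex of the graph, hence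
    \<open>walk_in_verts\<close>.\<close>
  have "walk \<Upsilon> (step_head \<Upsilon> s) [(e, 1 - i)] u"
    using e walk_in_verts(1)[OF Cons.prems] by (auto simp: s step_head_def step_tail_def)
  from walk_append[OF Cons.IH[OF p] this] show ?case
    by (simp add: reverse_walk_def s)
qed

text \<open>All edge signs are 1 or -1. Hence a connecting path traversed out and back contributes 1
  to the sign of a circuit walk.\<close>

lemma (in gain_signed_graph) walk_sign_square:
  "walk \<Upsilon> u p v \<Longrightarrow> walk_sign \<Upsilon> p * walk_sign \<Upsilon> p = 1"
proof (induction p arbitrary: u)
  case (Cons s p)
  then have "esign \<Upsilon> (fst s) \<in> {1, -1}" "walk_sign \<Upsilon> p * walk_sign \<Upsilon> p = 1"
    using esign_values[of "fst s"] by (auto simp: ordinary_edge_def)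
  then show ?case by auto
qed simp

section \<open>Simultaneous switching of signs and gains\<close>

text \<open>Switching is stated as a relation that fixes values only on actual edges and ends, so
  that it can be inverted. The sum over end positions treats links, loops, half edges and loose
  edges uniformly.\<close>

locale switched_graph = gain_signed_graph \<Upsilon>
  for \<Upsilon> :: "('v, 'e, 'k::field) gsg" +
  fixes \<Upsilon>' :: "('v, 'e, 'k) gsg" and \<zeta> :: "'v \<Rightarrow> int" and \<theta> :: "'v \<Rightarrow> 'k"
  assumes verts_switched [simp]: "verts \<Upsilon>' = verts \<Upsilon>"
    and edges_switched [simp]: "edges \<Upsilon>' = edges \<Upsilon>"
    and ends_switched [simp]: "ends \<Upsilon>' = ends \<Upsilon>"
    and switcher_values: "v \<in> verts \<Upsilon> \<Longrightarrow> \<zeta> v \<in> {1, -1}"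
    and esign_switched:
      "e \<in> edges \<Upsilon> \<Longrightarrow> length (ends \<Upsilon> e) = 2 \<Longrightarrow>
        esign \<Upsilon>' e = \<zeta> (ends \<Upsilon> e ! 0) * esign \<Upsilon> e * \<zeta> (ends \<Upsilon> e ! 1)"
    and esign_unswitched:
      "e \<in> edges \<Upsilon> \<Longrightarrow> length (ends \<Upsilon> e) \<noteq> 2 \<Longrightarrow> esign \<Upsilon>' e = esign \<Upsilon> e"
    and orient_switched:
      "e \<in> edges \<Upsilon> \<Longrightarrow> i < length (ends \<Upsilon> e) \<Longrightarrow>
        orient \<Upsilon>' e i = \<zeta> (ends \<Upsilon> e ! i) * orient \<Upsilon> e i"
    and gain_switched:
      "e \<in> edges \<Upsilon> \<Longrightarrow>
        gain \<Upsilon>' e =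
          gain \<Upsilon> e + (\<Sum>i<length (ends \<Upsilon> e). of_int (orient \<Upsilon> e i) * \<theta> (ends \<Upsilon> e ! i))"
begin

lemma end_in_verts: "e \<in> edges \<Upsilon> \<Longrightarrow> i < length (ends \<Upsilon> e) \<Longrightarrow> ends \<Upsilon> e ! i \<in> verts \<Upsilon>"
  using ends_in_verts[of e] nth_mem[of i "ends \<Upsilon> e"] by blast

lemma switcher_square: "v \<in> verts \<Upsilon> \<Longrightarrow> \<zeta> v * \<zeta> v = 1"
  using switcher_values[of v] by auto

lemma switcher_end:
  "e \<in> edges \<Upsilon> \<Longrightarrow> i < length (ends \<Upsilon> e) \<Longrightarrow> \<zeta> (ends \<Upsilon> e ! i) \<in> {1, -1}"
  by (intro switcher_values end_in_verts)

lemma gain_signed_graph_switched: "gain_signed_graph \<Upsilon>'"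
proof
  fix e assume e: "e \<in> edges \<Upsilon>'"
  then show "set (ends \<Upsilon>' e) \<subseteq> verts \<Upsilon>'" "length (ends \<Upsilon>' e) \<le> 2"
    using ends_in_verts at_most_two_ends by auto
  show "esign \<Upsilon>' e \<in> {1, -1}"
    using e esign_values[of e] switcher_end[of e 0] switcher_end[of e 1]
    by (cases "length (ends \<Upsilon> e) = 2") (auto simp: esign_switched esign_unswitched)
  show "esign \<Upsilon>' e = -1" if "length (ends \<Upsilon>' e) = 1"
    using that e half_edge_negative by (simp add: esign_unswitched)
  show "esign \<Upsilon>' e = 1" if "ends \<Upsilon>' e = []"
    using that e loose_edge_positive by (simp add: esign_unswitched)
  show "orient \<Upsilon>' e i \<in> {1, -1}" if "i < length (ends \<Upsilon>' e)" for i
    using that e orient_values[of e i] switcher_end[of e i] by (auto simp: orient_switched)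
  show "orient \<Upsilon>' e 0 * orient \<Upsilon>' e 1 = - esign \<Upsilon>' e" if "length (ends \<Upsilon>' e) = 2"
    using that e orient_esign[of e] switcher_end[of e 0] switcher_end[of e 1]
    by (auto simp: orient_switched esign_switched)
qed (use finite_verts finite_edges in simp_all)

text \<open>The sign switcher is its own inverse on vertices. The new orientation carries a factor
  \<zeta> v, which the factor \<zeta> v in the inverse gain switcher cancels. Symmetry reduces the
  equivalence of hyperbalance to one implication.\<close>

lemma switched_graph_sym: "switched_graph \<Upsilon>' \<Upsilon> \<zeta> (\<lambda>v. - (of_int (\<zeta> v) * \<theta> v))"
proof (intro switched_graph.intro switched_graph_axioms.intro gain_signed_graph_switched)
  fix e assume e: "e \<in> edges \<Upsilon>'"
  show "esign \<Upsilon> e = \<zeta> (ends \<Upsilon>' e ! 0) * esign \<Upsilon>' e * \<zeta> (ends \<Upsilon>' e ! 1)"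
    if "length (ends \<Upsilon>' e) = 2"
    using that e switcher_end[of e 0] switcher_end[of e 1] by (auto simp: esign_switched)
  show "esign \<Upsilon> e = esign \<Upsilon>' e" if "length (ends \<Upsilon>' e) \<noteq> 2"
    using that e by (simp add: esign_unswitched)
  show "orient \<Upsilon> e i = \<zeta> (ends \<Upsilon>' e ! i) * orient \<Upsilon>' e i" if "i < length (ends \<Upsilon>' e)" for i
    using that e switcher_end[of e i] by (auto simp: orient_switched)
  have "of_int (orient \<Upsilon>' e i) * - (of_int (\<zeta> (ends \<Upsilon>' e ! i)) * \<theta> (ends \<Upsilon>' e ! i))
      = - (of_int (orient \<Upsilon> e i) * \<theta> (ends \<Upsilon> e ! i))" if "i < length (ends \<Upsilon> e)" for i
    using that e switcher_end[of e i] by (auto simp: orient_switched)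
  then show "gain \<Upsilon> e = gain \<Upsilon>' e + (\<Sum>i<length (ends \<Upsilon>' e).
      of_int (orient \<Upsilon>' e i) * - (of_int (\<zeta> (ends \<Upsilon>' e ! i)) * \<theta> (ends \<Upsilon>' e ! i)))"
    using e by (simp add: gain_switched sum_negf del: mult_minus_right)
qed (use switcher_values in auto)

section \<open>Invariance of walks, circles and sign circuits\<close>

lemma edge_types_switched [simp]:
  "ordinary_edge \<Upsilon>' = ordinary_edge \<Upsilon>" "half_edge \<Upsilon>' = half_edge \<Upsilon>"
  "loose_edge \<Upsilon>' = loose_edge \<Upsilon>"
  by (auto simp: ordinary_edge_def half_edge_def loose_edge_def fun_eq_iff)

lemma step_switched [simp]: "step_tail \<Upsilon>' = step_tail \<Upsilon>" "step_head \<Upsilon>' = step_head \<Upsilon>"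
  by (auto simp: step_tail_def step_head_def fun_eq_iff)

lemma walk_switched [simp]: "walk \<Upsilon>' u p v = walk \<Upsilon> u p v"
  by (induction p arbitrary: u) auto

lemma subgraphs_switched [simp]:
  "verts_of \<Upsilon>' = verts_of \<Upsilon>" "degree_in \<Upsilon>' = degree_in \<Upsilon>"
  "walk_verts \<Upsilon>' = walk_verts \<Upsilon>" "path \<Upsilon>' = path \<Upsilon>"
  "connected_edges \<Upsilon>' = connected_edges \<Upsilon>" "once_around \<Upsilon>' = once_around \<Upsilon>"
  by (auto simp: verts_of_def degree_in_def walk_verts_def path_def connected_edges_def
      once_around_def fun_eq_iff)

lemma circle_switched [simp]: "circle \<Upsilon>' = circle \<Upsilon>"
  by (auto simp: circle_def fun_eq_iff)

text \<open>Each vertex of the circle contributes one factor \<zeta> v per edge end at it, hence the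
  square of \<zeta> v, which is 1.\<close>

lemma circle_sign_switched:
  assumes "circle \<Upsilon> C"
  shows "circle_sign \<Upsilon>' C = circle_sign \<Upsilon> C"
proof -
  let ?V = "verts_of \<Upsilon> C"
  have C: "e \<in> edges \<Upsilon>" "length (ends \<Upsilon> e) = 2" if "e \<in> C" for e
    using assms that by (auto simp: circle_def ordinary_edge_def)
  have V: "?V \<subseteq> verts \<Upsilon>"
    using C ends_in_verts by (auto simp: verts_of_def)
  then have fin: "finite ?V"
    using finite_verts finite_subset by blast
  have "esign \<Upsilon>' e = esign \<Upsilon> e * (\<Prod>v\<in>?V. \<zeta> v ^ count_list (ends \<Upsilon> e) v)" if "e \<in> C" for e
  proof -
    obtain v w where "ends \<Upsilon> e = [v, w]"
      using C(2)[OF \<open>e \<in> C\<close>] by (auto simp: length_Suc_conv numeral_2_eq_2)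
    then have "esign \<Upsilon>' e = esign \<Upsilon> e * prod_list (map \<zeta> (ends \<Upsilon> e))"
      using C[OF \<open>e \<in> C\<close>] by (simp add: esign_switched)
    moreover have "set (ends \<Upsilon> e) \<subseteq> ?V"
      using \<open>e \<in> C\<close> by (auto simp: verts_of_def)
    ultimately show ?thesis
      by (simp add: prod_list_map_eq_prod_power_count[OF fin])
  qed
  then have "circle_sign \<Upsilon>' C =
      circle_sign \<Upsilon> C * (\<Prod>e\<in>C. \<Prod>v\<in>?V. \<zeta> v ^ count_list (ends \<Upsilon> e) v)"
    by (simp add: circle_sign_def prod.distrib)
  \<comment> \<open>After the products are exchanged, the exponents at a fixed vertex add up to its
    degree.\<close>
  also have "(\<Prod>e\<in>C. \<Prod>v\<in>?V. \<zeta> v ^ count_list (ends \<Upsilon> e) v) = (\<Prod>v\<in>?V. \<zeta> v ^ degree_in \<Upsilon> C v)"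
    by (subst prod.swap) (simp add: degree_in_def power_sum)
  also have "\<dots> = (\<Prod>v\<in>?V. 1)"
  proof (rule prod.cong)
    fix v assume "v \<in> ?V"
    then show "\<zeta> v ^ degree_in \<Upsilon> C v = 1"
      using assms V switcher_square[of v] by (auto simp: circle_def power2_eq_square)
  qed simp
  finally show ?thesis by simp
qed

lemma sign_circuits_switched [simp]:
  "positive_circle \<Upsilon>' = positive_circle \<Upsilon>" "negative_circle \<Upsilon>' = negative_circle \<Upsilon>"
  "negative_figure \<Upsilon>' = negative_figure \<Upsilon>" "handcuff \<Upsilon>' = handcuff \<Upsilon>"
  "sign_circuit \<Upsilon>' = sign_circuit \<Upsilon>"
proof -
  show pos: "positive_circle \<Upsilon>' = positive_circle \<Upsilon>"
    and neg: "negative_circle \<Upsilon>' = negative_circle \<Upsilon>"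
    using circle_sign_switched by (auto simp: positive_circle_def negative_circle_def fun_eq_iff)
  show fig: "negative_figure \<Upsilon>' = negative_figure \<Upsilon>"
    by (simp add: negative_figure_def neg fun_eq_iff)
  show cuff: "handcuff \<Upsilon>' = handcuff \<Upsilon>"
    by (simp add: handcuff_def fig fun_eq_iff)
  show "sign_circuit \<Upsilon>' = sign_circuit \<Upsilon>"
    by (simp add: sign_circuit_def pos cuff fun_eq_iff)
qed

section \<open>Signs and gains of walks under switching\<close>

lemma step_sign_switched:
  assumes "e \<in> edges \<Upsilon>" "length (ends \<Upsilon> e) = 2" "i < 2"
  shows "esign \<Upsilon>' e = \<zeta> (step_tail \<Upsilon> (e, i)) * esign \<Upsilon> e * \<zeta> (step_head \<Upsilon> (e, i))"
  using assms by (auto simp: esign_switched step_tail_def step_head_def less_2_cases_iff)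

text \<open>Multiplication by the tail orientation turns its own \<theta> term into
  \<open>\<theta> u\<close>, because its square is 1, and the head term into
  \<open>- esign * \<theta> w\<close>, because the two orientations multiply to the negated edge
  sign. Ends are told apart by position, so loops are included.\<close>

lemma step_gain_switched:
  assumes e: "e \<in> edges \<Upsilon>" "length (ends \<Upsilon> e) = 2" "i < 2"
  defines "u \<equiv> step_tail \<Upsilon> (e, i)" and "w \<equiv> step_head \<Upsilon> (e, i)"
  shows "gain \<Upsilon>' e * of_int (orient \<Upsilon>' e i) =
    of_int (\<zeta> u) * (gain \<Upsilon> e * of_int (orient \<Upsilon> e i) + \<theta> u - of_int (esign \<Upsilon> e) * \<theta> w)"
proof -
  have tail: "orient \<Upsilon> e i * orient \<Upsilon> e i = 1"
    using e orient_values[of e i] by auto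
  have head: "orient \<Upsilon> e (1 - i) * orient \<Upsilon> e i = - esign \<Upsilon> e"
    using e orient_esign[of e] by (auto simp: less_2_cases_iff mult.commute)
  have "gain \<Upsilon>' e = gain \<Upsilon> e + of_int (orient \<Upsilon> e i) * \<theta> u + of_int (orient \<Upsilon> e (1 - i)) * \<theta> w"
    using e by (auto simp: gain_switched u_def w_def step_tail_def step_head_def less_2_cases_iff
        lessThan_nat_numeral lessThan_Suc)
  then have "gain \<Upsilon>' e * of_int (orient \<Upsilon>' e i) = of_int (\<zeta> u) * (gain \<Upsilon> e * of_int (orient \<Upsilon> e i)
      + of_int (orient \<Upsilon> e i * orient \<Upsilon> e i) * \<theta> u
      + of_int (orient \<Upsilon> e (1 - i) * orient \<Upsilon> e i) * \<theta> w)"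
    using e by (simp add: orient_switched u_def step_tail_def algebra_simps)
  then show ?thesis
    unfolding tail head by simp
qed

lemma walk_sign_switched: "walk \<Upsilon> u p v \<Longrightarrow> walk_sign \<Upsilon>' p = \<zeta> u * walk_sign \<Upsilon> p * \<zeta> v"
proof (induction p arbitrary: u)
  case Nil
  then show ?case by (auto simp: switcher_square)
next
  case (Cons s p)
  let ?w = "step_head \<Upsilon> s"
  from Cons.prems have w: "walk \<Upsilon> ?w p v" and "step_tail \<Upsilon> s = u"
    and "fst s \<in> edges \<Upsilon>" "length (ends \<Upsilon> (fst s)) = 2" "snd s < 2"
    by (auto simp: ordinary_edge_def)
  \<comment> \<open>One \<open>\<zeta> ?w\<close> comes from the head of the first step, the other
    from the induction hypothesis. They are kept together so that \<open>switcher_square\<close> can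
    turn them into 1.\<close>
  then have "walk_sign \<Upsilon>' (s # p) =
      \<zeta> u * esign \<Upsilon> (fst s) * (\<zeta> ?w * \<zeta> ?w) * walk_sign \<Upsilon> p * \<zeta> v"
    using step_sign_switched[of "fst s" "snd s"] Cons.IH[OF w] by simp
  then show ?case
    unfolding switcher_square[OF walk_in_verts(1)[OF w]] by simp
qed

text \<open>At every inner vertex the head term of one step cancels the tail term of the rest of the
  walk, weighted by the sign of that step; only the terms at \<open>u\<close> and \<open>v\<close>
  survive.\<close>

lemma walk_gain_switched:
  "walk \<Upsilon> u p v \<Longrightarrow>
    walk_gain \<Upsilon>' p = of_int (\<zeta> u) * (walk_gain \<Upsilon> p - \<theta> u + of_int (walk_sign \<Upsilon> p) * \<theta> v)"
proof (induction p arbitrary: u)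
  case (Cons s p)
  let ?w = "step_head \<Upsilon> s"
  from Cons.prems have w: "walk \<Upsilon> ?w p v" and tail: "step_tail \<Upsilon> s = u"
    and s: "fst s \<in> edges \<Upsilon>" "length (ends \<Upsilon> (fst s)) = 2" "snd s < 2"
    by (auto simp: ordinary_edge_def)
  have "walk_gain \<Upsilon>' (s # p) =
      - (of_int (\<zeta> u) * (gain \<Upsilon> (fst s) * of_int (orient \<Upsilon> (fst s) (snd s)) + \<theta> u
          - of_int (esign \<Upsilon> (fst s)) * \<theta> ?w))
      + of_int (\<zeta> u) * of_int (esign \<Upsilon> (fst s)) * of_int (\<zeta> ?w * \<zeta> ?w)
          * (walk_gain \<Upsilon> p - \<theta> ?w + of_int (walk_sign \<Upsilon> p) * \<theta> v)"
    using step_sign_switched[OF s] step_gain_switched[OF s] Cons.IH[OF w] tail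
    by (simp add: mult.assoc)
  then show ?case
    unfolding switcher_square[OF walk_in_verts(1)[OF w]] by (simp add: algebra_simps)
qed simp

lemma closed_walk_gain_switched:
  assumes "walk \<Upsilon> u p u" "walk_sign \<Upsilon> p = 1"
  shows "ultrawalk_gain \<Upsilon>' None p None = of_int (\<zeta> u) * ultrawalk_gain \<Upsilon> None p None"
  using walk_gain_switched[OF assms(1)] assms(2) by (simp add: ultrawalk_gain_def)

lemma half_edge_gain_switched:
  assumes "half_edge \<Upsilon> h" "u \<in> verts_of \<Upsilon> {h}"
  shows "of_int (orient \<Upsilon>' h 0) * gain \<Upsilon>' h =
    of_int (\<zeta> u) * (of_int (orient \<Upsilon> h 0) * gain \<Upsilon> h + \<theta> u)"
proof -
  have h: "h \<in> edges \<Upsilon>" "length (ends \<Upsilon> h) = 1" "ends \<Upsilon> h ! 0 = u"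
    using assms by (auto simp: half_edge_def verts_of_def length_Suc_conv)
  moreover have "orient \<Upsilon> h 0 \<in> {1, -1}"
    using h orient_values[of h 0] by simp
  ultimately show ?thesis
    by (auto simp: orient_switched gain_switched algebra_simps)
qed

text \<open>The \<theta> terms of the half edges cancel the boundary terms of the walk, whatever its
  sign. The half edges \<open>h\<close> and \<open>k\<close> may coincide, as in a handcuff with one
  circle.\<close>

lemma half_edge_walk_gain_switched:
  assumes h: "half_edge \<Upsilon> h" "u \<in> verts_of \<Upsilon> {h}"
    and k: "half_edge \<Upsilon> k" "v \<in> verts_of \<Upsilon> {k}"
    and p: "walk \<Upsilon> u p v"
  shows "ultrawalk_gain \<Upsilon>' (Some h) p (Some k) =
    of_int (\<zeta> u) * ultrawalk_gain \<Upsilon> (Some h) p (Some k)"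
proof -
  have vv: "\<zeta> v * \<zeta> v = 1"
    using walk_in_verts(2)[OF p] switcher_square by blast
  have "gain \<Upsilon>' k * of_int (walk_sign \<Upsilon>' p) * of_int (orient \<Upsilon>' k 0)
      = of_int (walk_sign \<Upsilon>' p) * (of_int (orient \<Upsilon>' k 0) * gain \<Upsilon>' k)"
    by simp
  also have "\<dots> = of_int (\<zeta> u) * of_int (walk_sign \<Upsilon> p) * of_int (\<zeta> v * \<zeta> v)
      * (of_int (orient \<Upsilon> k 0) * gain \<Upsilon> k + \<theta> v)"
    unfolding half_edge_gain_switched[OF k] walk_sign_switched[OF p]
    by (simp add: mult_ac)
  finally show ?thesis
    unfolding vv ultrawalk_gain_def option.case half_edge_gain_switched[OF h]
      walk_gain_switched[OF p]
    by (simp add: algebra_simps)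
qed

section \<open>Circuit gains and hyperbalance\<close>

text \<open>The same circuit walk is used in both graphs, and its gain changes by the factor \<zeta>
  u at its initial vertex. A value is thus preserved up to sign, which suffices for
  neutrality.\<close>

lemma circuit_gain_switched:
  assumes "circuit_gain \<Upsilon> D g"
  shows "circuit_gain \<Upsilon>' D g \<or> circuit_gain \<Upsilon>' D (- g)"
proof -
  have pm: "circuit_gain \<Upsilon>' D g \<or> circuit_gain \<Upsilon>' D (- g)"
    if "circuit_gain \<Upsilon>' D (of_int (\<zeta> u) * g)" "u \<in> verts \<Upsilon>" for D g u
    using that switcher_values[of u] by auto
  from assms show ?thesis
  proof cases
    case (loose e)
    then have "gain \<Upsilon>' e = g"
      by (simp add: gain_switched loose_edge_def)
    then show ?thesis
      using loose circuit_gain.loose[of \<Upsilon>' e] by simp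
  next
    case (circle u p)
    have p: "walk \<Upsilon> u p u"
      using circle by (simp add: once_around_def)
    moreover have "walk_sign \<Upsilon> p = 1"
      using circle walk_sign_eq_circle_sign[of \<Upsilon> D u p] by (simp add: positive_circle_def)
    ultimately have "ultrawalk_gain \<Upsilon>' None p None = of_int (\<zeta> u) * g"
      using circle by (simp add: closed_walk_gain_switched)
    with circle pm[of D u g] walk_in_verts(1)[OF p] circuit_gain.circle[of \<Upsilon>' D u p]
    show ?thesis by simp
  next
    case (circle_circle C1 u p v C2 q1 q2)
    let ?W = "q1 @ p @ q2 @ reverse_walk p"
    have walks: "walk \<Upsilon> u q1 u" "walk \<Upsilon> u p v" "walk \<Upsilon> v q2 v"
      using circle_circle handcuff_connecting_path(1) by (auto simp: once_around_def)
    then have W: "walk \<Upsilon> u ?W u"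
      by (blast intro: walk_append walk_reverse_walk)
    have "walk_sign \<Upsilon> q1 = -1" "walk_sign \<Upsilon> q2 = -1"
      using circle_circle walk_sign_eq_circle_sign[of \<Upsilon> C1 u q1]
        walk_sign_eq_circle_sign[of \<Upsilon> C2 v q2]
      by (simp_all add: negative_circle_def)
    \<comment> \<open>The two negative circles contribute -1 each, and the two passages along
      \<open>p\<close> cancel.\<close>
    then have "walk_sign \<Upsilon> ?W = 1"
      using walk_sign_square[OF walks(2)] by (simp add: walk_sign_reverse_walk)
    with W have "ultrawalk_gain \<Upsilon>' None ?W None = of_int (\<zeta> u) * g"
      using circle_circle by (simp add: closed_walk_gain_switched)
    with circle_circle pm[of D u g] walk_in_verts(1)[OF W]
      circuit_gain.circle_circle[of \<Upsilon>' C1 u p v C2 q1 q2]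
    show ?thesis by simp
  next
    case (half_circle h u p v C2 q2)
    let ?W = "p @ q2 @ reverse_walk p"
    have "walk \<Upsilon> u p v" "walk \<Upsilon> v q2 v" and h: "u \<in> verts_of \<Upsilon> {h}"
      using half_circle handcuff_connecting_path by (auto simp: once_around_def)
    then have W: "walk \<Upsilon> u ?W u"
      by (blast intro: walk_append walk_reverse_walk)
    \<comment> \<open>The walk leaves from \<open>h\<close> and returns to it, so the lemma on half
      edges applies with \<open>k = h\<close> and \<open>v = u\<close>.\<close>
    with h have "ultrawalk_gain \<Upsilon>' (Some h) ?W (Some h) = of_int (\<zeta> u) * g"
      using half_circle by (simp add: half_edge_walk_gain_switched)
    with half_circle pm[of D u g] walk_in_verts(1)[OF W]
      circuit_gain.half_circle[of \<Upsilon>' h u p v C2 q2]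
    show ?thesis by simp
  next
    case (half_half h u p v k)
    have W: "walk \<Upsilon> u p v" and hk: "u \<in> verts_of \<Upsilon> {h}" "v \<in> verts_of \<Upsilon> {k}"
      using handcuff_connecting_path[OF half_half(3)] by blast+
    then have "ultrawalk_gain \<Upsilon>' (Some h) p (Some k) = of_int (\<zeta> u) * g"
      using half_half by (simp add: half_edge_walk_gain_switched)
    with half_half pm[of D u g] walk_in_verts(1)[OF W]
      circuit_gain.half_half[of \<Upsilon>' h u p v k]
    show ?thesis by simp
  qed
qed

lemma hyperbalanced_if_switched: "hyperbalanced \<Upsilon>' S \<Longrightarrow> hyperbalanced \<Upsilon> S"
  using circuit_gain_switched unfolding hyperbalanced_def neutral_circuit_def
  by (metis neg_equal_0_iff_equal sign_circuits_switched(5))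

end

lemma (in switched_graph) hyperbalanced_switched_iff: "hyperbalanced \<Upsilon> S \<longleftrightarrow> hyperbalanced \<Upsilon>' S"
  using hyperbalanced_if_switched switched_graph.hyperbalanced_if_switched[OF switched_graph_sym]
  by blast

section \<open>Sign switching and gain switching as special cases\<close>

lemma (in gain_signed_graph) switched_graph_sign_switch:
  assumes "\<And>v. v \<in> verts \<Upsilon> \<Longrightarrow> \<zeta> v \<in> {1, -1}"
  shows "switched_graph \<Upsilon> (sign_switch \<Upsilon> \<zeta>) \<zeta> (\<lambda>_. 0)"
  by unfold_locales
    (use assms in \<open>auto simp: sign_switch_def length_Suc_conv numeral_2_eq_2 split: list.split\<close>)

lemma (in gain_signed_graph) switched_graph_gain_switch:
  "switched_graph \<Upsilon> (gain_switch \<Upsilon> \<theta>) (\<lambda>_. 1) \<theta>"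
proof unfold_locales
  fix e assume "e \<in> edges \<Upsilon>"
  then show "gain (gain_switch \<Upsilon> \<theta>) e =
      gain \<Upsilon> e + (\<Sum>i<length (ends \<Upsilon> e). of_int (orient \<Upsilon> e i) * \<theta> (ends \<Upsilon> e ! i))"
    \<comment> \<open>The default branch of \<open>gain_switch\<close> then covers only loose edges,
      where the sum over ends is empty.\<close>
    using at_most_two_ends[of e] by (auto simp: gain_switch_def split: list.split)
qed (simp_all add: gain_switch_def)

theorem theorem2p11:
  fixes \<Upsilon> :: "('v, 'e, 'k::field) gsg"
    and \<zeta> :: "'v \<Rightarrow> int"
    and \<theta> :: "'v \<Rightarrow> 'k"
    and S :: "'e set"
  assumes "CHAR('k) \<noteq> 2"
    and "gain_signed_graph \<Upsilon>"
    and "\<And>v. v \<in> verts \<Upsilon> \<Longrightarrow> \<zeta> v \<in> {1, -1}"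
    and "S \<subseteq> edges \<Upsilon>"
  shows "(hyperbalanced \<Upsilon> S \<longleftrightarrow> hyperbalanced (sign_switch \<Upsilon> \<zeta>) S)
       \<and> (hyperbalanced \<Upsilon> S \<longleftrightarrow> hyperbalanced (gain_switch \<Upsilon> \<theta>) S)"
proof -
  interpret gain_signed_graph \<Upsilon> by fact
  have "switched_graph \<Upsilon> (sign_switch \<Upsilon> \<zeta>) \<zeta> (\<lambda>_. 0)"
    by (rule switched_graph_sign_switch) (fact assms(3))
  with switched_graph_gain_switch[of \<theta>] show ?thesis
    using switched_graph.hyperbalanced_switched_iff by blast
qed

end
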